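(* Let $\alpha>0$, $\lambda$, $\bar F$, $\bar\psi$ be as in the context, and suppose that there are constants $\underline\lambda,\overline\lambda$ with $0<\underline\lambda\le\lambda(s)\le\overline\lambda<\infty$ for all $s\ge0$, and that $0<\bar\psi<\infty$. For $t>0$, let $G(t)$ be a random variable distributed as $\mathcal N(0,\bar m_0(t))$, where $\bar m_0(t)=\bar\psi\int_0^t\lambda(s)\bar F_s(t-s)\,ds$. Then there exist two constants $0<c_1<c_2<\infty$ such that for all $t\ge1$: $$c_1\,t^{1-\alpha}\le\mathbb E[G(t)^2]\le c_2\,t^{1-\alpha}\quad\text{if }\alpha\in(0,1),$$ $$c_1\le\mathbb E[G(t)^2]\le c_2\quad\text{if }\alpha\in(1,\infty).$$
   Context: $\lambda:[0,\infty)\to\mathbb R_+$ and $\psi:\mathbb R^d\to\mathbb R_+$ are positive, bounded and Lipschitz, and $\bar\psi=\int_{\mathbb R^d}\psi(z)\,\pi(dz)$, where $\pi$ is a probability measure on $\mathbb R^d$ (the unique invariant probability measure of the environment process $Z$). $\{\nu(s,dr);s\ge0\}$ is a family of probability laws (service time laws) on $[0,\infty)$ with densities, $\nu(s,dr)=\ell_s(r)\,dr$, and there are $\alpha>0$ and constants $c,C>0$ such that for all $r,s>0$: $c\,(r^{-1-\alpha}\wedge1)\le\ell_s(r)\le C\,(r^{-1-\alpha}\wedge1)$ and $\frac{\partial\ell_s(r)}{\partial s}\le C\,(r^{-1-\alpha}\wedge1)$. Set $\bar F_s(r)=\int_r^\infty\ell_s(\tau)\,d\tau$. *)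

theory Defs
  imports "HOL-Probability.Probability"
begin

definition psi_bar :: "'b measure \<Rightarrow> ('b \<Rightarrow> real) \<Rightarrow> real" where
  "psi_bar \<pi> \<psi> = (\<integral>z. \<psi> z \<partial>\<pi>)"

definition tail_F :: "(real \<Rightarrow> real \<Rightarrow> real) \<Rightarrow> real \<Rightarrow> real \<Rightarrow> real" where
  "tail_F l s r = (LINT \<tau>:{r..}|lborel. l s \<tau>)"

definition m0_bar ::
  "'b measure \<Rightarrow> ('b \<Rightarrow> real) \<Rightarrow> (real \<Rightarrow> real) \<Rightarrow> (real \<Rightarrow> real \<Rightarrow> real) \<Rightarrow> real \<Rightarrow> real" where
  "m0_bar \<pi> \<psi> lam l t =
     psi_bar \<pi> \<psi> * (LINT s:{0..t}|lborel. lam s * tail_F l s (t - s))"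

text \<open>The normal law is parametrised by its variance \<open>v\<close>, whereas \<^const>\<open>normal_density\<close>
  takes the standard deviation. The case \<open>v = 0\<close> is the point mass, which has no density.\<close>
definition normal_law :: "real \<Rightarrow> real \<Rightarrow> real measure" where
  "normal_law \<mu> v =
     (if v = 0 then return borel \<mu>
      else density lborel (\<lambda>x. ennreal (normal_density \<mu> (sqrt v) x)))"

text \<open>\<open>\<nu> s\<close>, for \<open>s \<ge> 0\<close>, is a probability law on the half-line \<open>{0..}\<close> with Lebesgue
  density \<open>l s\<close>; values of \<open>l s\<close> on the negative half-line play no role.\<close>
definition service_laws ::
  "(real \<Rightarrow> real measure) \<Rightarrow> (real \<Rightarrow> real \<Rightarrow> real) \<Rightarrow> bool" where
  "service_laws \<nu> l \<longleftrightarrow>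
     (\<forall>s\<ge>0. prob_space (\<nu> s) \<and>
        l s \<in> borel_measurable (restrict_space lborel {0..}) \<and>
        (\<forall>r\<ge>0. 0 \<le> l s r) \<and>
        \<nu> s = density (restrict_space lborel {0..}) (\<lambda>r. ennreal (l s r)))"

end

(* Up to constants the tail of the service law at r is min (r powr - alpha) 1, so the variance is
   comparable to the integral of this function over {0..t}. For the lower bound it is enough to
   integrate over the last d time units, where the tail is at least of order d powr - alpha; take
   d = t if alpha < 1 and d = 1 if alpha > 1. Since the densities are differentiable in s, dominated
   convergence makes s \<mapsto> tail_F l s (t - s) continuous, so that it is integrable. *)
theory Submission
  imports Defs
begin

section \<open>Set integrals with respect to Lebesgue measure\<close>

lemma set_lebesgue_integral_eq_of_has_integral:
  fixes f :: "real \<Rightarrow> real"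
  assumes "f \<in> borel_measurable borel" "A \<in> sets borel" "\<And>x. x \<in> A \<Longrightarrow> 0 \<le> f x"
    and "(f has_integral I) A"
  shows "set_integrable lborel A f" "(LINT x:A|lborel. f x) = I"
proof -
  have "f absolutely_integrable_on A"
    using assms by (intro nonnegative_absolutely_integrable_1) (auto simp: integrable_on_def)
  \<comment> \<open>Absolute integrability refers to the completed measure; since \<open>f\<close>
    and \<open>A\<close> are Borel, it descends to \<open>lborel\<close>.\<close>
  then show int: "set_integrable lborel A f"
    using assms(1,2) unfolding set_integrable_def
    by (subst (asm) integrable_completion) auto
  show "(LINT x:A|lborel. f x) = I"
    using set_borel_integral_eq_integral(2)[OF int] integral_unique[OF assms(4)] by simp
qed

lemma set_integral_mono_set:
  fixes f :: "'a \<Rightarrow> real"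
  assumes "set_integrable M B f" "A \<in> sets M" "A \<subseteq> B" "\<And>x. x \<in> B \<Longrightarrow> 0 \<le> f x"
  shows "(LINT x:A|M. f x) \<le> (LINT x:B|M. f x)"
  using set_integrable_subset[OF assms(1-3)] assms(1) unfolding set_lebesgue_integral_def set_integrable_def
  by (rule integral_mono) (use assms(3,4) in \<open>auto simp: indicator_def\<close>)

text \<open>The service densities are known to be measurable only on the half-line. Cutting them off
  to a Borel subset of it yields functions that are measurable on the whole line.\<close>

lemma set_borel_measurable_restrict_space:
  fixes f :: "real \<Rightarrow> real"
  assumes "f \<in> borel_measurable (restrict_space lborel B)" "A \<subseteq> B" "A \<in> sets borel" "B \<in> sets borel"
  shows "set_borel_measurable lborel A f"
proof -
  have "f \<in> borel_measurable (restrict_space lborel A)"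
    using measurable_restrict_mono[OF assms(1,2)] .
  then show ?thesis
    using assms(3) by (simp add: borel_measurable_restrict_space_iff set_borel_measurable_def)
qed

lemma set_integrable_const_interval:
  "set_integrable lborel {a<..<b::real} (\<lambda>_. k::real)"
  by (rule set_integrable_subset[OF borel_integrable_atLeastAtMost'[of a b]]) auto

section \<open>The decay kernel and its integrals\<close>

definition decay_kernel :: "real \<Rightarrow> real \<Rightarrow> real" where
  "decay_kernel a r = min (r powr (- 1 - a)) 1"

lemma borel_measurable_decay_kernel [measurable]: "decay_kernel a \<in> borel_measurable borel"
  unfolding decay_kernel_def by measurable

lemma decay_kernel_nonneg: "0 \<le> decay_kernel a r"
  by (simp add: decay_kernel_def)

lemma decay_kernel_eq:
  assumes "1 \<le> r" "0 \<le> a"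
  shows "decay_kernel a r = r powr (- 1 - a)"
  using assms powr_mono[of "- 1 - a" 0 r] by (simp add: decay_kernel_def)

lemma powr_tail_integral:
  fixes a d :: real
  assumes "0 < a" "0 < d"
  shows "set_integrable lborel {d..} (\<lambda>r. r powr (- 1 - a))"
    and "(LINT r:{d..}|lborel. r powr (- 1 - a)) = d powr (- a) / a"
proof -
  have "((\<lambda>r. r powr (- 1 - a)) has_integral d powr (- a) / a) {d..}"
    using has_integral_powr_to_inf[of "- 1 - a" d] assms by (simp add: field_simps)
  note * = set_lebesgue_integral_eq_of_has_integral[OF _ _ _ this]
  show "set_integrable lborel {d..} (\<lambda>r. r powr (- 1 - a))"
    "(LINT r:{d..}|lborel. r powr (- 1 - a)) = d powr (- a) / a"
    by (rule *; simp)+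
qed

lemma decay_kernel_integral:
  assumes "0 < a"
  shows "set_integrable lborel {0..} (decay_kernel a)"
    and "(LINT r:{0..}|lborel. decay_kernel a r) \<le> 1 + 1 / a"
proof -
  \<comment> \<open>Splitting at 1 lets each branch of the minimum act as a majorant: the cap
    contributes at most 1 below the split, the power 1 / a above it.\<close>
  have *: "{0..} = {0..<1} \<union> {1::real..}" "{0..<1} \<inter> {1::real..} = {}"
    by auto
  have one: "set_integrable lborel {0..<1::real} (\<lambda>_. 1::real)"
    by (simp add: set_integrable_def)
  have head: "set_integrable lborel {0..<1} (decay_kernel a)"
    by (rule set_integrable_bound[OF one])
       (simp_all add: set_borel_measurable_def decay_kernel_def)
  have tail: "set_integrable lborel {1..} (decay_kernel a)"
    by (rule set_integrable_bound[OF powr_tail_integral(1)[OF assms, of 1]])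
       (simp_all add: set_borel_measurable_def decay_kernel_def)
  show "set_integrable lborel {0..} (decay_kernel a)"
    unfolding * by (intro set_integrable_Un head tail) auto
  have "(LINT r:{0..}|lborel. decay_kernel a r)
      = (LINT r:{0..<1}|lborel. decay_kernel a r) + (LINT r:{1..}|lborel. decay_kernel a r)"
    unfolding *(1) by (rule set_integral_Un[OF *(2) head tail])
  also have "\<dots> \<le> (LINT r:{0..<1::real}|lborel. 1) + (LINT r:{1..}|lborel. r powr (- 1 - a))"
    by (intro add_mono set_integral_mono head tail one powr_tail_integral(1) assms)
       (auto simp: decay_kernel_def)
  also have "\<dots> = 1 + 1 / a"
    using powr_tail_integral(2)[OF assms, of 1] by (simp add: set_lebesgue_integral_def)
  finally show "(LINT r:{0..}|lborel. decay_kernel a r) \<le> 1 + 1 / a" .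
qed

lemma set_integrable_decay_kernel:
  assumes "0 < a" "0 \<le> r"
  shows "set_integrable lborel {r..} (decay_kernel a)"
  by (rule set_integrable_subset[OF decay_kernel_integral(1)[OF assms(1)]]) (use assms in auto)

text \<open>Shrinking the domain to \<open>{d..}\<close> leaves only points above 1, where the cap
  is inactive and the integral is explicit. The bound is uniform in \<open>r \<le> d\<close>, so it
  can be used on a whole window of length \<open>d\<close>.\<close>

lemma decay_kernel_tail_lower:
  assumes "0 < a" "0 \<le> r" "r \<le> d" "1 \<le> d"
  shows "d powr (- a) / a \<le> (LINT x:{r..}|lborel. decay_kernel a x)"
proof -
  have "d powr (- a) / a = (LINT x:{d..}|lborel. x powr (- 1 - a))"
    using powr_tail_integral(2)[of a d] assms by simp
  also have "\<dots> = (LINT x:{d..}|lborel. decay_kernel a x)"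
    using assms by (intro set_lebesgue_integral_cong) (auto simp: decay_kernel_eq)
  also have "\<dots> \<le> (LINT x:{r..}|lborel. decay_kernel a x)"
    using assms by (intro set_integral_mono_set set_integrable_decay_kernel decay_kernel_nonneg) auto
  finally show ?thesis .
qed

text \<open>Integration lowers the order of decay by one, and \<open>decay_kernel (a - 1) r\<close>
  is \<open>min (r powr (- a)) 1\<close>. For \<open>r\<close> at least 1 the power tail needs only
  the factor 1 / a; for smaller \<open>r\<close> the kernel on the right is 1 and the factor is the
  bound for the total mass.\<close>

lemma decay_kernel_tail_upper:
  assumes "0 < a" "0 < r"
  shows "(LINT x:{r..}|lborel. decay_kernel a x) \<le> (1 + 1 / a) * decay_kernel (a - 1) r"
proof (cases "1 \<le> r")
  case True
  have "(LINT x:{r..}|lborel. decay_kernel a x) \<le> (LINT x:{r..}|lborel. x powr (- 1 - a))"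
    using assms
    by (intro set_integral_mono set_integrable_decay_kernel powr_tail_integral(1))
       (auto simp: decay_kernel_def)
  also have "\<dots> = 1 / a * r powr (- a)"
    using powr_tail_integral(2)[OF assms] by simp
  also have "\<dots> \<le> (1 + 1 / a) * r powr (- a)"
    by (intro mult_right_mono) auto
  also have "r powr (- a) = decay_kernel (a - 1) r"
    using assms powr_mono[of "- a" 0 r] True by (simp add: decay_kernel_def)
  finally show ?thesis .
next
  case False
  have "(LINT x:{r..}|lborel. decay_kernel a x) \<le> (LINT x:{0..}|lborel. decay_kernel a x)"
    using assms by (intro set_integral_mono_set decay_kernel_integral(1) decay_kernel_nonneg) auto
  also have "\<dots> \<le> 1 + 1 / a"
    by (rule decay_kernel_integral(2)[OF assms(1)])
  also have "\<dots> = (1 + 1 / a) * decay_kernel (a - 1) r"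
    using assms False powr_mono2'[of "- a" r 1] by (simp add: decay_kernel_def)
  finally show ?thesis .
qed

text \<open>The cap at 1 makes this hold for every exponent, in particular for the shifted parameter
  \<open>a - 1\<close>, which may be negative.\<close>

lemma set_integrable_decay_kernel_bounded:
  "set_integrable lborel {0<..<t} (decay_kernel a)"
  by (rule set_integrable_bound[OF set_integrable_const_interval[of 0 t 1]])
     (simp_all add: set_borel_measurable_def decay_kernel_def)

text \<open>Removing the cap only enlarges the integrand, and the power stays integrable at 0
  because \<open>a < 1\<close>.\<close>

lemma decay_kernel_integral_small_exponent:
  assumes "a < 1" "0 \<le> t"
  shows "(LINT r:{0<..<t}|lborel. decay_kernel (a - 1) r) \<le> t powr (1 - a) / (1 - a)"
proof -
  have "((\<lambda>r. r powr (- a)) has_integral t powr (1 - a) / (1 - a)) {0..t}"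
    using has_integral_powr_from_0[of "- a" t] assms by (simp add: add.commute)
  note * = set_lebesgue_integral_eq_of_has_integral[OF _ _ _ this, simplified]
  have "(LINT r:{0<..<t}|lborel. decay_kernel (a - 1) r) \<le> (LINT r:{0<..<t}|lborel. r powr (- a))"
    by (intro set_integral_mono set_integrable_decay_kernel_bounded set_integrable_subset[OF *(1)])
       (auto simp: decay_kernel_def)
  also have "\<dots> \<le> (LINT r:{0..t}|lborel. r powr (- a))"
    by (intro set_integral_mono_set *(1)) auto
  finally show ?thesis
    using *(2) by simp
qed

text \<open>Here \<open>a - 1\<close> is positive, so the kernel is integrable over the whole
  half-line and its mass there bounds the integral for all \<open>t\<close> at once.\<close>

lemma decay_kernel_integral_large_exponent:
  assumes "1 < a"
  shows "(LINT r:{0<..<t}|lborel. decay_kernel (a - 1) r) \<le> 1 + 1 / (a - 1)"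
proof -
  have "(LINT r:{0<..<t}|lborel. decay_kernel (a - 1) r)
      \<le> (LINT r:{0..}|lborel. decay_kernel (a - 1) r)"
    using assms by (intro set_integral_mono_set decay_kernel_integral(1) decay_kernel_nonneg) auto
  also have "\<dots> \<le> 1 + 1 / (a - 1)"
    using assms by (intro decay_kernel_integral(2)) auto
  finally show ?thesis .
qed

section \<open>Reflection of the time interval and continuity of the tail in its parameter\<close>

lemma set_integral_reflect:
  fixes f :: "real \<Rightarrow> real"
  shows "(LINT s:{0<..<t}|lborel. f (t - s)) = (LINT r:{0<..<t}|lborel. f r)"
    and "set_integrable lborel {0<..<t} (\<lambda>s. f (t - s)) \<longleftrightarrow> set_integrable lborel {0<..<t} f"
proof -
  have "indicator {0<..<t} (t - s) = (indicator {0<..<t} s :: real)" for s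
    by (auto simp: indicator_def)
  then show "(LINT s:{0<..<t}|lborel. f (t - s)) = (LINT r:{0<..<t}|lborel. f r)"
    and "set_integrable lborel {0<..<t} (\<lambda>s. f (t - s)) \<longleftrightarrow> set_integrable lborel {0<..<t} f"
    using lborel_integral_real_affine[of "- 1" "\<lambda>r. indicator {0<..<t} r * f r" t]
      lborel_integrable_real_affine_iff[of "- 1" "\<lambda>r. indicator {0<..<t} r * f r" t]
    by (simp_all add: set_lebesgue_integral_def set_integrable_def)
qed

text \<open>Both the integrand and the domain \<open>{g s..}\<close> vary with \<open>s\<close>.
  Putting the domain into the integrand as an indicator makes dominated convergence along sequences
  applicable, with \<open>h\<close> as the common majorant.\<close>

lemma continuous_on_tail_F:
  fixes l :: "real \<Rightarrow> real \<Rightarrow> real" and g :: "real \<Rightarrow> real"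
  assumes meas: "\<And>s. s \<in> S \<Longrightarrow> l s \<in> borel_measurable (restrict_space lborel {0..})"
    and h: "set_integrable lborel {0..} h"
    and bound: "\<And>s r. s \<in> S \<Longrightarrow> 0 < r \<Longrightarrow> \<bar>l s r\<bar> \<le> h r"
    and cont: "\<And>r. 0 < r \<Longrightarrow> continuous_on S (\<lambda>s. l s r)"
    and g: "continuous_on S g" "\<And>s. s \<in> S \<Longrightarrow> 0 \<le> g s"
  shows "continuous_on S (\<lambda>s. tail_F l s (g s))"
  unfolding continuous_on_sequentially
proof safe
  fix x a
  assume x: "\<forall>n. x n \<in> S" and a: "a \<in> S" and lim: "x \<longlonglongrightarrow> a"
  let ?f = "\<lambda>s \<tau>. indicator {g s..} \<tau> * l s \<tau>"
  have f_meas: "?f s \<in> borel_measurable lborel" if "s \<in> S" for s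
    using set_borel_measurable_restrict_space[OF meas[OF that], of "{g s..}"] g(2)[OF that]
    by (simp add: set_borel_measurable_def)
  \<comment> \<open>At \<open>g a\<close> the indicators may fail to converge, and at 0 neither the
    bound nor the continuity in \<open>s\<close> is assumed.\<close>
  have null: "AE \<tau> in lborel. \<tau> \<noteq> 0 \<and> \<tau> \<noteq> g a"
    using AE_lborel_singleton[of 0] AE_lborel_singleton[of "g a"] by eventually_elim auto
  have g_lim: "(\<lambda>n. g (x n)) \<longlonglongrightarrow> g a"
    using g(1) x a lim unfolding continuous_on_sequentially by (auto simp: o_def)
  have "(\<lambda>n. integral\<^sup>L lborel (?f (x n))) \<longlonglongrightarrow> integral\<^sup>L lborel (?f a)"
  proof (rule integral_dominated_convergence)
    show "integrable lborel (\<lambda>\<tau>. indicator {0..} \<tau> * h \<tau>)"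
      using h by (simp add: set_integrable_def)
    show "?f a \<in> borel_measurable lborel" "\<And>n. ?f (x n) \<in> borel_measurable lborel"
      using f_meas a x by auto
    show "AE \<tau> in lborel. norm (?f (x n) \<tau>) \<le> indicator {0..} \<tau> * h \<tau>" for n
      using null
    proof eventually_elim
      case (elim \<tau>)
      \<comment> \<open>Where the indicator of \<open>{g (x n)..}\<close> vanishes at a positive
        point, nonnegativity of \<open>h\<close> is what remains to be shown; it follows from the
        bound on the absolute value of \<open>l\<close>.\<close>
      then show ?case
        using bound[of "x n" \<tau>] g(2)[of "x n"] x
        by (cases "0 < \<tau>") (auto simp: indicator_def abs_mult intro: order_trans[OF abs_ge_zero])
    qed
    show "AE \<tau> in lborel. (\<lambda>n. ?f (x n) \<tau>) \<longlonglongrightarrow> ?f a \<tau>"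
      using null
    proof eventually_elim
      case (elim \<tau>)
      show ?case
      proof (cases "0 < \<tau>")
        case True
        have "(\<lambda>n. l (x n) \<tau>) \<longlonglongrightarrow> l a \<tau>"
          using cont[OF True] x a lim unfolding continuous_on_sequentially by (auto simp: o_def)
        \<comment> \<open>Away from \<open>g a\<close> the indicators are eventually constant,
          because \<open>g (x n)\<close> ends up on the same side of the point as
          \<open>g a\<close>.\<close>
        moreover have "(\<lambda>n. indicator {g (x n)..} \<tau> :: real) \<longlonglongrightarrow> indicator {g a..} \<tau>"
        proof (cases "\<tau> < g a")
          case True
          then have "eventually (\<lambda>n. \<tau> < g (x n)) sequentially"
            using g_lim by (rule order_tendstoD(1)[rotated])
          then show ?thesis
            using True by (intro tendsto_eventually) (auto elim: eventually_mono)
        next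
          case False
          then have "g a < \<tau>" using elim by auto
          then have "eventually (\<lambda>n. g (x n) < \<tau>) sequentially"
            using g_lim by (rule order_tendstoD(2)[rotated])
          then show ?thesis
            using \<open>g a < \<tau>\<close> by (intro tendsto_eventually) (auto elim: eventually_mono)
        qed
        ultimately show ?thesis
          by (intro tendsto_mult)
      next
        case False
        \<comment> \<open>The point is now negative, hence below every \<open>g s\<close>.\<close>
        then have "?f s \<tau> = 0" if "s \<in> S" for s
          using g(2)[OF that] elim by (auto simp: indicator_def)
        then have "?f a \<tau> = 0" "\<And>n. ?f (x n) \<tau> = 0"
          using x a by blast+
        then show ?thesis
          by (simp only: tendsto_const)
      qed
    qed
  qed
  then show "((\<lambda>s. tail_F l s (g s)) \<circ> x) \<longlonglongrightarrow> tail_F l a (g a)"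
    by (simp add: tail_F_def set_lebesgue_integral_def o_def)
qed

section \<open>The second moment of the centred normal law\<close>

lemma normal_law_second_moment:
  assumes "0 \<le> v"
  shows "(\<integral>x. x\<^sup>2 \<partial>normal_law 0 v) = v"
proof (cases "v = 0")
  case True
  then show ?thesis
    by (simp add: normal_law_def integral_return)
next
  case False
  have "(\<integral>x. x\<^sup>2 \<partial>normal_law 0 v) = (\<integral>x. normal_density 0 (sqrt v) x * x\<^sup>2 \<partial>lborel)"
    using False by (simp add: normal_law_def integral_density normal_density_nonneg)
  \<comment> \<open>This is the even moment of order 2k at k = 1, whose coefficient (2k)! / (2^k k!)
    equals 1.\<close>
  also have "\<dots> = v"
    using integral_normal_moment_even[of "sqrt v" 0 1] assms False by (simp add: fact_numeral)
  finally show ?thesis .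
qed

section \<open>Two-sided bounds for the tails and for their weighted integral\<close>

lemma tail_F_bounds:
  assumes meas: "l s \<in> borel_measurable (restrict_space lborel {0..})"
    and a: "0 < a" and r: "0 \<le> r"
    and lower: "\<And>x. 0 < x \<Longrightarrow> c * decay_kernel a x \<le> l s x" and c: "0 \<le> c"
    and upper: "\<And>x. 0 < x \<Longrightarrow> l s x \<le> C * decay_kernel a x"
  shows "c * (LINT x:{r..}|lborel. decay_kernel a x) \<le> tail_F l s r"
    and "tail_F l s r \<le> C * (LINT x:{r..}|lborel. decay_kernel a x)"
proof -
  \<comment> \<open>The density bounds hold only at positive points, while the domain contains 0
    when \<open>r = 0\<close>; all comparisons below are therefore almost everywhere.\<close>
  have pos: "AE x in lborel. x \<in> {r..} \<longrightarrow> 0 < x"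
    using AE_lborel_singleton[of 0] by eventually_elim (use r in auto)
  have k: "set_integrable lborel {r..} (\<lambda>x. b * decay_kernel a x)" for b
    using set_integrable_decay_kernel[OF a r] by simp
  have nn: "0 \<le> l s x" if "0 < x" for x
    using lower[OF that] mult_nonneg_nonneg[OF c decay_kernel_nonneg[of a x]] by linarith
  have int: "set_integrable lborel {r..} (l s)"
  proof (rule set_integrable_bound[OF k[of C]])
    show "set_borel_measurable lborel {r..} (l s)"
      by (rule set_borel_measurable_restrict_space[OF meas]) (use r in auto)
    show "AE x in lborel. x \<in> {r..} \<longrightarrow> norm (l s x) \<le> norm (C * decay_kernel a x)"
      using pos
    proof eventually_elim
      case (elim x)
      then show ?case
        using nn[of x] upper[of x] by (cases "0 < x") auto
    qed
  qed
  have "(LINT x:{r..}|lborel. c * decay_kernel a x) \<le> (LINT x:{r..}|lborel. l s x)"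
    by (rule set_integral_mono_AE[OF k int]) (use pos lower in \<open>auto elim!: eventually_mono\<close>)
  then show "c * (LINT x:{r..}|lborel. decay_kernel a x) \<le> tail_F l s r"
    by (simp add: tail_F_def)
  have "(LINT x:{r..}|lborel. l s x) \<le> (LINT x:{r..}|lborel. C * decay_kernel a x)"
    by (rule set_integral_mono_AE[OF int k]) (use pos upper in \<open>auto elim!: eventually_mono\<close>)
  then show "tail_F l s r \<le> C * (LINT x:{r..}|lborel. decay_kernel a x)"
    by (simp add: tail_F_def)
qed

text \<open>The window length \<open>d\<close> is left free so that one lower bound covers both
  ranges of the exponent. Bounds on the density are required only for positive \<open>s\<close>, so
  the work is done on the open interval.\<close>

lemma weighted_tail_integral_bounds:
  fixes lam :: "real \<Rightarrow> real" and l :: "real \<Rightarrow> real \<Rightarrow> real"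
  assumes lam_cont: "continuous_on {0..} lam"
    and lam: "\<And>s. 0 \<le> s \<Longrightarrow> lam_lo \<le> lam s \<and> lam s \<le> lam_hi" and lam_lo: "0 \<le> lam_lo"
    and meas: "\<And>s. 0 < s \<Longrightarrow> l s \<in> borel_measurable (restrict_space lborel {0..})"
    and cont: "\<And>r. 0 < r \<Longrightarrow> continuous_on {0<..} (\<lambda>s. l s r)"
    and a: "0 < a" and c: "0 \<le> c" and C: "0 \<le> C"
    and lower: "\<And>s x. 0 < s \<Longrightarrow> 0 < x \<Longrightarrow> c * decay_kernel a x \<le> l s x"
    and upper: "\<And>s x. 0 < s \<Longrightarrow> 0 < x \<Longrightarrow> l s x \<le> C * decay_kernel a x"
  shows "1 \<le> d \<Longrightarrow> d \<le> t \<Longrightarrow>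
           lam_lo * c / a * d powr (1 - a) \<le> (LINT s:{0..t}|lborel. lam s * tail_F l s (t - s))"
    and "0 \<le> t \<Longrightarrow> (LINT s:{0..t}|lborel. lam s * tail_F l s (t - s))
           \<le> lam_hi * C * (1 + 1 / a) * (LINT r:{0<..<t}|lborel. decay_kernel (a - 1) r)"
proof -
  let ?F = "\<lambda>s. lam s * tail_F l s (t - s)"
  let ?K = "\<lambda>r. LINT x:{r..}|lborel. decay_kernel a x"
  let ?U = "\<lambda>r. lam_hi * C * (1 + 1 / a) * decay_kernel (a - 1) r"
  have lam_hi: "0 \<le> lam_hi"
    using lam[of 0] lam_lo by linarith
  have K_nn: "0 \<le> ?K r" for r
    by (simp add: set_lebesgue_integral_def decay_kernel_nonneg)
  have tail: "c * ?K (t - s) \<le> tail_F l s (t - s)" "tail_F l s (t - s) \<le> C * ?K (t - s)"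
    if "s \<in> {0<..<t}" for s
    using that by (auto intro!: tail_F_bounds[where c = c and C = C] meas a lower c upper)
  have tail_nn: "0 \<le> tail_F l s (t - s)" if "s \<in> {0<..<t}" for s
    using tail(1)[OF that] mult_nonneg_nonneg[OF c K_nn[of "t - s"]] by linarith
  have F_nn: "0 \<le> ?F s" if "s \<in> {0<..<t}" for s
    using tail_nn[OF that] lam[of s] lam_lo that by auto
  have F_le: "?F s \<le> ?U (t - s)" if "s \<in> {0<..<t}" for s
  proof -
    have "?F s \<le> lam_hi * (C * ?K (t - s))"
      using that lam[of s] lam_hi tail(2) tail_nn by (intro mult_mono) auto
    also have "\<dots> \<le> lam_hi * (C * ((1 + 1 / a) * decay_kernel (a - 1) (t - s)))"
      using that a C lam_hi by (intro mult_left_mono decay_kernel_tail_upper) auto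
    finally show ?thesis by (simp add: mult.assoc)
  qed
  \<comment> \<open>Measurability of each \<open>l s\<close> in its own argument does not control
    the dependence on \<open>s\<close>. Continuity provides it, and the majorant \<open>?U\<close>
    then gives integrability.\<close>
  have "continuous_on {0<..<t} (\<lambda>s. tail_F l s (t - s))"
  proof (rule continuous_on_tail_F)
    show "set_integrable lborel {0..} (\<lambda>r. C * decay_kernel a r)"
      using decay_kernel_integral(1)[OF a] by simp
    show "\<bar>l s r\<bar> \<le> C * decay_kernel a r" if "s \<in> {0<..<t}" "0 < r" for s r
      using lower[of s r] upper[of s r] that mult_nonneg_nonneg[OF c decay_kernel_nonneg[of a r]] by auto
    show "continuous_on {0<..<t} (\<lambda>s. l s r)" if "0 < r" for r
      by (rule continuous_on_subset[OF cont[OF that]]) auto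
  qed (use meas in \<open>auto intro!: continuous_intros\<close>)
  then have "continuous_on {0<..<t} ?F"
    by (intro continuous_on_mult continuous_on_subset[OF lam_cont]) auto
  then have F_meas: "set_borel_measurable lborel {0<..<t} ?F"
    using borel_measurable_continuous_on_indicator[of "{0<..<t}" ?F]
    by (simp add: set_borel_measurable_def)
  \<comment> \<open>The majorant depends on \<open>s\<close> only through \<open>t - s\<close>, so
    reflection reduces it to the kernel itself.\<close>
  have U_int: "set_integrable lborel {0<..<t} (\<lambda>s. ?U (t - s))"
    using set_integrable_decay_kernel_bounded[of t "a - 1"] set_integral_reflect(2)[of t ?U] by simp
  have F_int: "set_integrable lborel {0<..<t} ?F"
    by (rule set_integrable_bound[OF U_int F_meas])
       (use F_nn F_le in \<open>auto intro!: AE_I2 order_trans[OF _ abs_ge_self]\<close>)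
  \<comment> \<open>The two intervals differ by a finite set, which is null.\<close>
  have open_eq: "(LINT s:{0..t}|lborel. ?F s) = (LINT s:{0<..<t}|lborel. ?F s)"
    by (rule set_integral_discrete_difference[of "{0, t}"]) auto
  show "(LINT s:{0..t}|lborel. ?F s)
      \<le> lam_hi * C * (1 + 1 / a) * (LINT r:{0<..<t}|lborel. decay_kernel (a - 1) r)" if "0 \<le> t"
  proof -
    have "(LINT s:{0<..<t}|lborel. ?F s) \<le> (LINT s:{0<..<t}|lborel. ?U (t - s))"
      by (rule set_integral_mono[OF F_int U_int F_le])
    also have "\<dots> = (LINT r:{0<..<t}|lborel. ?U r)"
      by (rule set_integral_reflect)
    finally show ?thesis
      using open_eq by simp
  qed
  show "lam_lo * c / a * d powr (1 - a) \<le> (LINT s:{0..t}|lborel. ?F s)" if "1 \<le> d" "d \<le> t"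
  proof -
    \<comment> \<open>A constant lower bound for the integrand on the window: there
      \<open>t - s\<close> is at most \<open>d\<close>, so \<open>decay_kernel_tail_lower\<close>
      applies.\<close>
    define B where "B = lam_lo * (c * (d powr (- a) / a))"
    have "B \<le> ?F s" if s: "s \<in> {t - d<..<t}" for s
    proof -
      have s': "s \<in> {0<..<t}" using s \<open>d \<le> t\<close> by auto
      have "B \<le> lam_lo * (c * ?K (t - s))"
        unfolding B_def using s s' a c lam_lo \<open>1 \<le> d\<close>
        by (intro mult_left_mono decay_kernel_tail_lower) auto
      also have "\<dots> \<le> ?F s"
        using s' lam[of s] lam_lo c tail(1)[OF s'] K_nn by (intro mult_mono) auto
      finally show ?thesis .
    qed
    then have "(LINT s:{t - d<..<t}|lborel. B) \<le> (LINT s:{t - d<..<t}|lborel. ?F s)"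
      using \<open>d \<le> t\<close> by (intro set_integral_mono set_integrable_subset[OF F_int]
          set_integrable_const_interval) auto
    also have "\<dots> \<le> (LINT s:{0<..<t}|lborel. ?F s)"
      using \<open>d \<le> t\<close> F_nn by (intro set_integral_mono_set[OF F_int]) auto
    \<comment> \<open>This rewrites the left end of the chain: the window has length
      \<open>d\<close>, and its product with \<open>d powr (- a)\<close> is
      \<open>d powr (1 - a)\<close>.\<close>
    also have "(LINT s:{t - d<..<t}|lborel. B) = d * B"
      using \<open>1 \<le> d\<close> by (simp add: set_lebesgue_integral_def)
    also have "d * B = lam_lo * c / a * d powr (1 - a)"
      using \<open>1 \<le> d\<close> by (simp add: B_def powr_diff powr_minus field_simps)
    finally show ?thesis
      using open_eq by simp
  qed
qed

section \<open>Growth of the variance in the two ranges of the exponent\<close>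

theorem proposition3p12:
  fixes lam :: "real \<Rightarrow> real"
    and \<psi> :: "real ^ 'd \<Rightarrow> real"
    and \<pi> :: "(real ^ 'd) measure"
    and \<nu> :: "real \<Rightarrow> real measure"
    and l :: "real \<Rightarrow> real \<Rightarrow> real"
    and \<alpha> c C lam_lo lam_hi :: real
    and M :: "'a measure"
    and G :: "real \<Rightarrow> 'a \<Rightarrow> real"
  assumes lam_pos: "\<And>s. 0 \<le> s \<Longrightarrow> 0 < lam s"
    and lam_bounded: "bounded (lam ` {0..})"
    and lam_lipschitz: "\<exists>L. L-lipschitz_on {0..} lam"
    and psi_pos: "\<And>z. 0 < \<psi> z"
    and psi_bounded: "bounded (range \<psi>)"
    and psi_lipschitz: "\<exists>L. L-lipschitz_on UNIV \<psi>"
    and pi_prob: "prob_space \<pi>"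
    and pi_borel: "sets \<pi> = sets borel"
    and laws: "service_laws \<nu> l"
    and alpha_pos: "0 < \<alpha>"
    and c_pos: "0 < c"
    and C_pos: "0 < C"
    and l_lower: "\<And>r s. 0 < r \<Longrightarrow> 0 < s \<Longrightarrow> c * min (r powr (- 1 - \<alpha>)) 1 \<le> l s r"
    and l_upper: "\<And>r s. 0 < r \<Longrightarrow> 0 < s \<Longrightarrow> l s r \<le> C * min (r powr (- 1 - \<alpha>)) 1"
    and l_diff: "\<And>r s. 0 < r \<Longrightarrow> 0 < s \<Longrightarrow> (\<lambda>s. l s r) differentiable (at s)"
    and l_deriv: "\<And>r s. 0 < r \<Longrightarrow> 0 < s \<Longrightarrow>
                    deriv (\<lambda>s. l s r) s \<le> C * min (r powr (- 1 - \<alpha>)) 1"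
    and lam_lo_pos: "0 < lam_lo"
    and lam_bounds: "\<And>s. 0 \<le> s \<Longrightarrow> lam_lo \<le> lam s \<and> lam s \<le> lam_hi"
    and psi_bar_pos: "0 < psi_bar \<pi> \<psi>"
    and psi_bar_finite: "integrable \<pi> \<psi>"
    and M_prob: "prob_space M"
    and G_rv: "\<And>t. 0 < t \<Longrightarrow> G t \<in> borel_measurable M"
    and G_law: "\<And>t. 0 < t \<Longrightarrow> distr M borel (G t) = normal_law 0 (m0_bar \<pi> \<psi> lam l t)"
  shows "\<exists>c1 c2. 0 < c1 \<and> c1 < c2 \<and>
           (\<forall>t\<ge>1.
              (\<alpha> \<in> {0<..<1} \<longrightarrow>
                 c1 * t powr (1 - \<alpha>) \<le> prob_space.expectation M (\<lambda>\<omega>. (G t \<omega>)\<^sup>2) \<and>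
                 prob_space.expectation M (\<lambda>\<omega>. (G t \<omega>)\<^sup>2) \<le> c2 * t powr (1 - \<alpha>)) \<and>
              (\<alpha> \<in> {1<..} \<longrightarrow>
                 c1 \<le> prob_space.expectation M (\<lambda>\<omega>. (G t \<omega>)\<^sup>2) \<and>
                 prob_space.expectation M (\<lambda>\<omega>. (G t \<omega>)\<^sup>2) \<le> c2))"
proof -
  let ?E = "\<lambda>t. prob_space.expectation M (\<lambda>\<omega>. (G t \<omega>)\<^sup>2)"
  let ?p = "psi_bar \<pi> \<psi>"
  let ?I = "\<lambda>t. LINT s:{0..t}|lborel. lam s * tail_F l s (t - s)"
  \<comment> \<open>\<open>A\<close> and \<open>B\<close> are the constants of the lower and upper
    bounds for the weighted tail integral, multiplied by \<open>psi_bar\<close>.\<close>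
  define A where "A = ?p * (lam_lo * c / \<alpha>)"
  define B where "B = ?p * (lam_hi * C * (1 + 1 / \<alpha>))"
  have lam_hi: "0 < lam_hi"
    using lam_bounds[of 0] lam_lo_pos by auto
  have A_pos: "0 < A" and B_pos: "0 < B"
    using psi_bar_pos lam_lo_pos c_pos alpha_pos lam_hi C_pos by (simp_all add: A_def B_def add_pos_pos)
  have lam_cont: "continuous_on {0..} lam"
    using lam_lipschitz lipschitz_on_continuous_on by blast
  have meas: "l s \<in> borel_measurable (restrict_space lborel {0..})" if "0 < s" for s
    using laws that by (simp add: service_laws_def)
  have cont: "continuous_on {0<..} (\<lambda>s. l s r)" if "0 < r" for r
    using l_diff[OF that] by (intro continuous_at_imp_continuous_on ballI differentiable_imp_continuous_within) auto
  have lower: "c * decay_kernel \<alpha> x \<le> l s x" and upper: "l s x \<le> C * decay_kernel \<alpha> x"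
    if "0 < s" "0 < x" for s x
    using l_lower l_upper that by (simp_all add: decay_kernel_def)
  have I_lower: "lam_lo * c / \<alpha> * d powr (1 - \<alpha>) \<le> ?I t" if "1 \<le> d" "d \<le> t" for d t
    by (rule weighted_tail_integral_bounds(1)[where c = c and C = C and lam_hi = lam_hi])
       (use that lam_cont lam_bounds lam_lo_pos meas cont alpha_pos c_pos C_pos lower upper in simp_all)
  have I_upper: "?I t \<le> lam_hi * C * (1 + 1 / \<alpha>) * (LINT r:{0<..<t}|lborel. decay_kernel (\<alpha> - 1) r)"
    if "0 \<le> t" for t
    by (rule weighted_tail_integral_bounds(2)[where c = c and C = C and lam_lo = lam_lo])
       (use that lam_cont lam_bounds lam_lo_pos meas cont alpha_pos c_pos C_pos lower upper in simp_all)
  have m_lower: "A * d powr (1 - \<alpha>) \<le> m0_bar \<pi> \<psi> lam l t" if "1 \<le> d" "d \<le> t" for d t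
  proof -
    have "?p * (lam_lo * c / \<alpha> * d powr (1 - \<alpha>)) \<le> ?p * ?I t"
      using psi_bar_pos that by (intro mult_left_mono I_lower) auto
    then show ?thesis
      by (simp add: A_def m0_bar_def mult.assoc)
  qed
  have m_upper: "m0_bar \<pi> \<psi> lam l t \<le> B * (LINT r:{0<..<t}|lborel. decay_kernel (\<alpha> - 1) r)"
    if "1 \<le> t" for t
  proof -
    have "?p * ?I t \<le> ?p * (lam_hi * C * (1 + 1 / \<alpha>) * (LINT r:{0<..<t}|lborel. decay_kernel (\<alpha> - 1) r))"
      using psi_bar_pos that by (intro mult_left_mono I_upper) auto
    then show ?thesis
      by (simp add: B_def m0_bar_def mult.assoc)
  qed
  have E_eq: "?E t = m0_bar \<pi> \<psi> lam l t" if "1 \<le> t" for t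
  proof -
    \<comment> \<open>The second moment of \<open>normal_law\<close> equals its parameter only if
      that is nonnegative; the lower bound with a window of length 1 ensures this.\<close>
    have "0 \<le> m0_bar \<pi> \<psi> lam l t"
      using m_lower[of 1 t] that A_pos by simp
    then have "m0_bar \<pi> \<psi> lam l t = (\<integral>x. x\<^sup>2 \<partial>distr M borel (G t))"
      using G_law[of t] that by (simp add: normal_law_second_moment)
    also have "\<dots> = ?E t"
      using G_rv[of t] that by (intro integral_distr) auto
    finally show ?thesis ..
  qed
  show ?thesis
  proof (cases "\<alpha> < 1")
    case True
    \<comment> \<open>The upper estimate alone would give \<open>B / (1 - \<alpha>)\<close>; adding
      \<open>A\<close> makes the strict inequality between the two witnesses immediate.\<close>
    have "?E t \<le> (A + B / (1 - \<alpha>)) * t powr (1 - \<alpha>)" if "1 \<le> t" for t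
    proof -
      have "?E t \<le> B * (t powr (1 - \<alpha>) / (1 - \<alpha>))"
        unfolding E_eq[OF that] using B_pos that
        by (intro order_trans[OF m_upper] mult_left_mono
            decay_kernel_integral_small_exponent[OF True]) auto
      also have "\<dots> \<le> (A + B / (1 - \<alpha>)) * t powr (1 - \<alpha>)"
        using A_pos by (simp add: distrib_right)
      finally show ?thesis .
    qed
    then show ?thesis
      using True A_pos B_pos m_lower[of t t for t] E_eq
      by (intro exI[of _ A] exI[of _ "A + B / (1 - \<alpha>)"]) auto
  next
    case False
    have "?E t \<le> A + B * (1 + 1 / (\<alpha> - 1))" if "1 \<le> t" "1 < \<alpha>" for t
    proof -
      have "?E t \<le> B * (1 + 1 / (\<alpha> - 1))"
        unfolding E_eq[OF that(1)] using B_pos that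
        by (intro order_trans[OF m_upper] mult_left_mono
            decay_kernel_integral_large_exponent) auto
      then show ?thesis
        using A_pos by simp
    qed
    \<comment> \<open>This case includes \<open>\<alpha> = 1\<close>, where both implications of the
      goal are vacuous but the witnesses must still be strictly ordered. There the quotient is 0 by
      the convention for division by zero, so the expression is \<open>B\<close>.\<close>
    moreover have "0 < B * (1 + 1 / (\<alpha> - 1))"
      using B_pos False by (intro mult_pos_pos add_pos_nonneg) auto
    ultimately show ?thesis
      using False A_pos m_lower[of 1 t for t] E_eq
      by (intro exI[of _ A] exI[of _ "A + B * (1 + 1 / (\<alpha> - 1))"]) auto
  qed
qed

end
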